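(* Let $0<\theta<1$, let $m\ge 1$ be an enrichment level of the surrogate-guided offline-adaptive GMsFEM described in the context, let $\eta_{m,1}^2,\dots,\eta_{m,N}^2$ be the exact local residual indicators and $\tilde\eta_{m,1}^2,\dots,\tilde\eta_{m,N}^2$ the predicted (surrogate) scores at level $m$, and let $S_m=\{\sigma_m(1),\dots,\sigma_m(k_m)\}\subseteq\{1,\dots,N\}$ be the set of marked neighborhoods. Assume that the predicted scores are nonnegative, i.e. $\tilde\eta_{m,i}^2\ge 0$ for all $i$, and that, for numbers $\varepsilon_{m,i}\ge 0$, $$\left|\tilde{\eta}_{m,i}^2-\eta_{m,i}^2\right|\le\varepsilon_{m,i},\qquad i=1,\ldots,N.$$ If $S_m$ satisfies the predicted D\"orfler condition $$\sum_{i\in S_m}\tilde{\eta}_{m,i}^2\ge\theta\sum_{i=1}^N\tilde{\eta}_{m,i}^2,$$ then $$\sum_{i\in S_m}\eta_{m,i}^2\ \ge\ \theta\sum_{i=1}^N\eta_{m,i}^2-\theta\sum_{i=1}^N\varepsilon_{m,i}-\sum_{i\in S_m}\varepsilon_{m,i}.$$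
   Context: Discretization. $D\subset\mathbb{R}^d$ is a bounded domain; the problem is $-\nabla\cdot(\kappa\nabla u)=f$ in $D$, $u=0$ on $\partial D$, with a heterogeneous high-contrast coefficient $\kappa$. $\mathcal{T}^H$ is a conforming coarse partition of $D$ with mesh size $H$ and coarse nodes $x_1,\dots,x_N$; the coarse neighborhood $\omega_i$ is the union of the coarse elements $K\in\mathcal{T}^H$ with $x_i\in\overline K$. $V$ is the conforming piecewise-linear finite element space with homogeneous boundary condition on a conforming refinement $\mathcal{T}^h$ of $\mathcal{T}^H$. Put $a(v,w)=\int_D\kappa\nabla v\cdot\nabla w\,dx$ and $(f,v)=\int_D fv\,dx$. Offline basis. The local snapshot space $V_{\mathrm{snap}}^{\omega_i}$ is spanned by the fine-grid $\kappa$-harmonic extensions into $\omega_i$ of the discrete delta functions at the $L_i$ fine nodes of $\partial\omega_i$. The multiscale partition-of-unity function $\chi_i$ solves, on each coarse element $K\subset\omega_i$, $-\nabla\cdot(\kappa\nabla\chi_i)=0$ in $K$, with boundary values on $\partial K$ equal to the continuous piecewise-linear coarse nodal function that is $1$ at $x_i$ and $0$ at the other vertices of $K$. Let $(\lambda_k^{\omega_i},\phi_k^{\omega_i})$, $0<\lambda_1^{\omega_i}\le\dots\le\lambda_{L_i}^{\omega_i}$, be the eigenpairs in $V_{\mathrm{snap}}^{\omega_i}$ of $\int_{\omega_i}\kappa\nabla\phi\cdot\nabla\varphi\,dx=\lambda\int_{\omega_i}\widetilde\kappa\,\phi\varphi\,dx$ for all $\varphi\in V_{\mathrm{snap}}^{\omega_i}$,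 where $\widetilde\kappa=\kappa\sum_{r=1}^N H^2|\nabla\chi_r|^2$. The offline basis functions are $\psi_k^{\omega_i}=\chi_i\phi_k^{\omega_i}$. Exact indicators. At level $m$, $V_{\mathrm{off}}^m$ is the span of $\psi_k^{\omega_i}$, $1\le k\le l_i^m$, $1\le i\le N$, and $u_{\mathrm{ms}}^m\in V_{\mathrm{off}}^m$ solves $a(u_{\mathrm{ms}}^m,v)=(f,v)$ for all $v\in V_{\mathrm{off}}^m$. With $V_i=H_0^1(\omega_i)\cap V$, $\|v\|_{V_i}^2=\int_{\omega_i}\kappa|\nabla v|^2dx$, and $R_{m,i}(v)=\int_{\omega_i}fv\,dx-\int_{\omega_i}\kappa\nabla u_{\mathrm{ms}}^m\cdot\nabla v\,dx$ for $v\in V_i$, the exact indicator is $\eta_{m,i}^2=\|R_{m,i}\|_{V_i^*}^2\,(\lambda_{l_i^m+1}^{\omega_i})^{-1}\ge 0$, where $\|\cdot\|_{V_i^*}$ is the dual norm of $\|\cdot\|_{V_i}$. Surrogate scores and marking. $\tilde\eta_{m,i}^2\in\mathbb{R}$ denotes the score predicted for neighborhood $\omega_i$ at level $m$ by a pre-trained Gaussian-process posterior mean evaluated at a feature vector of $(\omega_i,m)$; the superscript $2$ is only notation and the predicted score is a real number. A permutation $\sigma_m$ of $\{1,\dots,N\}$ is chosen with $\tilde\eta_{m,\sigma_m(1)}^2\ge\dots\ge\tilde\eta_{m,\sigma_m(N)}^2$, $k_m$ is the smallest integer with $\theta\sum_{i=1}^N\tilde\eta_{m,i}^2\le\sum_{j=1}^{k_m}\tilde\eta_{m,\sigma_m(j)}^2$,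 and $S_m=\{\sigma_m(1),\dots,\sigma_m(k_m)\}$. The marked neighborhoods are enriched by their next $s\ge1$ offline basis functions to form $V_{\mathrm{off}}^{m+1}$. *)

theory Defs
  imports "HOL-Analysis.Analysis" "HOL-Combinatorics.Permutations"
begin

section \<open>Sobolev spaces\<close>

primrec C_k :: "nat \<Rightarrow> ('a::euclidean_space \<Rightarrow> real) \<Rightarrow> bool" where
  "C_k 0 f \<longleftrightarrow> continuous_on UNIV f"
| "C_k (Suc k) f \<longleftrightarrow> (\<forall>x. f differentiable (at x)) \<and>
     (\<forall>b\<in>Basis. C_k k (\<lambda>x. frechet_derivative f (at x) b))"

definition test_functions :: "'a::euclidean_space set \<Rightarrow> ('a \<Rightarrow> real) set" where
  "test_functions \<Omega> = {\<phi>. (\<forall>k. C_k k \<phi>) \<and>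
     compact (closure {x. \<phi> x \<noteq> 0}) \<and> closure {x. \<phi> x \<noteq> 0} \<subseteq> \<Omega>}"

definition gradient :: "('a::euclidean_space \<Rightarrow> real) \<Rightarrow> 'a \<Rightarrow> 'a" where
  "gradient \<phi> x = (\<Sum>b\<in>Basis. frechet_derivative \<phi> (at x) b *\<^sub>R b)"

definition L2 :: "'a::euclidean_space set \<Rightarrow> ('a \<Rightarrow> 'b::euclidean_space) set" where
  "L2 \<Omega> = {v. set_borel_measurable lebesgue \<Omega> v \<and>
              set_integrable lebesgue \<Omega> (\<lambda>x. (norm (v x))\<^sup>2)}"

definition has_weak_gradient ::
  "'a::euclidean_space set \<Rightarrow> ('a \<Rightarrow> real) \<Rightarrow> ('a \<Rightarrow> 'a) \<Rightarrow> bool" where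
  "has_weak_gradient \<Omega> v g \<longleftrightarrow> v \<in> L2 \<Omega> \<and> g \<in> L2 \<Omega> \<and>
     (\<forall>\<phi>\<in>test_functions \<Omega>. \<forall>b\<in>Basis.
        (LINT x:\<Omega>|lebesgue. v x * (gradient \<phi> x \<bullet> b)) = - (LINT x:\<Omega>|lebesgue. (g x \<bullet> b) * \<phi> x))"

definition H1 :: "'a::euclidean_space set \<Rightarrow> ('a \<Rightarrow> real) set" where
  "H1 \<Omega> = {v. \<exists>g. has_weak_gradient \<Omega> v g}"

text \<open>The weak gradient is unique only almost everywhere; it is used below only under integrals,
  where the choice is immaterial.\<close>

definition weak_gradient :: "'a::euclidean_space set \<Rightarrow> ('a \<Rightarrow> real) \<Rightarrow> 'a \<Rightarrow> 'a" where
  "weak_gradient \<Omega> v = (SOME g. has_weak_gradient \<Omega> v g)"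

text \<open>Elements of \<open>H\<^sub>0\<^sup>1(\<Omega>)\<close> are regarded as functions on the whole space, extended by zero.\<close>

definition H10 :: "'a::euclidean_space set \<Rightarrow> ('a \<Rightarrow> real) set" where
  "H10 \<Omega> = {v \<in> H1 UNIV. \<exists>\<phi>. (\<forall>n. \<phi> n \<in> test_functions \<Omega>) \<and>
     (\<lambda>n. LINT x|lebesgue. (\<phi> n x - v x)\<^sup>2) \<longlonglongrightarrow> 0 \<and>
     (\<lambda>n. LINT x|lebesgue. (norm (gradient (\<phi> n) x - weak_gradient UNIV v x))\<^sup>2) \<longlonglongrightarrow> 0}"

definition fun_span :: "('a \<Rightarrow> real) set \<Rightarrow> ('a \<Rightarrow> real) set" where
  "fun_span B = {\<lambda>x. \<Sum>\<psi>\<in>F. c \<psi> * \<psi> x |F c. finite F \<and> F \<subseteq> B}"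

definition affine_fun_on :: "'a::euclidean_space set \<Rightarrow> ('a \<Rightarrow> real) \<Rightarrow> bool" where
  "affine_fun_on T v \<longleftrightarrow> (\<exists>a b. \<forall>x\<in>T. v x = a \<bullet> x + b)"


section \<open>Discretization\<close>

text \<open>Mesh elements are closed sets. Indices of nodes and basis functions start at 1.\<close>

record 'a gmsfem =
  dom :: "'a set"
  kappa :: "'a \<Rightarrow> real"
  source :: "'a \<Rightarrow> real"
  coarse_mesh :: "'a set set"
  fine_mesh :: "'a set set"
  num_nodes :: nat
  node :: "nat \<Rightarrow> 'a"
  pou :: "nat \<Rightarrow> 'a \<Rightarrow> real"             \<comment> \<open>\<open>\<chi>\<^sub>i\<close>\<close>
  eigval :: "nat \<Rightarrow> nat \<Rightarrow> real"           \<comment> \<open>\<open>\<lambda>\<^sub>k\<close> on \<open>\<omega>\<^sub>i\<close>, arguments \<open>i k\<close>\<close>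
  eigfun :: "nat \<Rightarrow> nat \<Rightarrow> 'a \<Rightarrow> real"    \<comment> \<open>\<open>\<phi>\<^sub>k\<close> on \<open>\<omega>\<^sub>i\<close>, arguments \<open>i k\<close>\<close>

definition mesh_nodes :: "'a::euclidean_space set set \<Rightarrow> 'a set" where
  "mesh_nodes \<T> = {p. \<exists>K\<in>\<T>. p extreme_point_of K}"

text \<open>Coarse elements may be arbitrary convex polytopes whose facets are simplices (simplices in any
  dimension, all convex polygons in the plane), so that a continuous piecewise linear function on
  the boundary of an element is determined by its values at the vertices. The list of coarse nodes
  contains all interior vertices; whether vertices on the boundary of the domain are listed as well
  is left open.\<close>

definition discretization :: "'a::euclidean_space gmsfem \<Rightarrow> bool" where
  "discretization P \<longleftrightarrow>
     open (dom P) \<and> connected (dom P) \<and> bounded (dom P) \<and> dom P \<noteq> {} \<and>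
     set_borel_measurable lebesgue (dom P) (kappa P) \<and>
     (\<exists>c C. 0 < c \<and> (\<forall>x\<in>dom P. c \<le> kappa P x \<and> kappa P x \<le> C)) \<and>
     source P \<in> L2 (dom P) \<and>
     finite (coarse_mesh P) \<and>
     (\<forall>K\<in>coarse_mesh P. polytope K \<and> aff_dim K = int DIM('a) \<and>
        (\<forall>F. F facet_of K \<longrightarrow> (int DIM('a) - 1) simplex F)) \<and>
     (\<forall>K\<in>coarse_mesh P. \<forall>K'\<in>coarse_mesh P. (K \<inter> K') face_of K \<and> (K \<inter> K') face_of K') \<and>
     dom P = interior (\<Union>(coarse_mesh P)) \<and>
     triangulation (fine_mesh P) \<and> (\<forall>T\<in>fine_mesh P. int DIM('a) simplex T) \<and>
     (\<forall>T\<in>fine_mesh P. \<exists>K\<in>coarse_mesh P. T \<subseteq> K) \<and> \<Union>(fine_mesh P) = \<Union>(coarse_mesh P) \<and>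
     inj_on (node P) {1..num_nodes P} \<and>
     mesh_nodes (coarse_mesh P) \<inter> dom P \<subseteq> node P ` {1..num_nodes P} \<and>
     node P ` {1..num_nodes P} \<subseteq> mesh_nodes (coarse_mesh P)"

definition mesh_size :: "'a::euclidean_space gmsfem \<Rightarrow> real" where
  "mesh_size P = Max (diameter ` coarse_mesh P)"

definition nbhd :: "'a::euclidean_space gmsfem \<Rightarrow> nat \<Rightarrow> 'a set" where
  "nbhd P i = \<Union>{K \<in> coarse_mesh P. node P i \<in> K}"

definition fe_space :: "'a::euclidean_space gmsfem \<Rightarrow> ('a \<Rightarrow> real) set" where
  "fe_space P = {v. continuous_on (closure (dom P)) v \<and> (\<forall>T\<in>fine_mesh P. affine_fun_on T v) \<and>
     (\<forall>x. x \<notin> dom P \<longrightarrow> v x = 0)}"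

definition energy ::
  "'a::euclidean_space gmsfem \<Rightarrow> 'a set \<Rightarrow> ('a \<Rightarrow> real) \<Rightarrow> ('a \<Rightarrow> real) \<Rightarrow> real" where
  "energy P \<Omega> v w =
     (LINT x:\<Omega>|lebesgue. kappa P x * (weak_gradient \<Omega> v x \<bullet> weak_gradient \<Omega> w x))"

definition load ::
  "'a::euclidean_space gmsfem \<Rightarrow> 'a set \<Rightarrow> ('a \<Rightarrow> real) \<Rightarrow> real" where
  "load P \<Omega> v = (LINT x:\<Omega>|lebesgue. source P x * v x)"


section \<open>Offline basis\<close>

definition partition_functions :: "'a::euclidean_space gmsfem \<Rightarrow> bool" where
  "partition_functions P \<longleftrightarrow>
     (\<forall>i\<in>{1..num_nodes P}.
        (\<forall>x. x \<notin> nbhd P i \<longrightarrow> pou P i x = 0) \<and>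
        (\<forall>K\<in>coarse_mesh P. node P i \<in> K \<longrightarrow>
           continuous_on K (pou P i) \<and> pou P i \<in> H1 (interior K) \<and>
           (\<forall>F. F facet_of K \<longrightarrow> affine_fun_on F (pou P i)) \<and>
           (\<forall>p. p extreme_point_of K \<longrightarrow> pou P i p = (if p = node P i then 1 else 0)) \<and>
           (\<forall>\<phi>\<in>test_functions (interior K).
              (LINT x:interior K|lebesgue.
                 kappa P x * (weak_gradient (interior K) (pou P i) x \<bullet> gradient \<phi> x)) = 0)))"

definition local_fe_space :: "'a::euclidean_space gmsfem \<Rightarrow> nat \<Rightarrow> ('a \<Rightarrow> real) set" where
  "local_fe_space P i = {v. continuous_on (nbhd P i) v \<and>
     (\<forall>T\<in>fine_mesh P. T \<subseteq> nbhd P i \<longrightarrow> affine_fun_on T v) \<and> (\<forall>x. x \<notin> nbhd P i \<longrightarrow> v x = 0)}"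

definition boundary_nodes :: "'a::euclidean_space gmsfem \<Rightarrow> nat \<Rightarrow> 'a set" where
  "boundary_nodes P i = mesh_nodes (fine_mesh P) \<inter> frontier (nbhd P i)"

definition num_snapshots :: "'a::euclidean_space gmsfem \<Rightarrow> nat \<Rightarrow> nat" where
  "num_snapshots P i = card (boundary_nodes P i)"

definition harmonic_extension ::
  "'a::euclidean_space gmsfem \<Rightarrow> nat \<Rightarrow> 'a \<Rightarrow> ('a \<Rightarrow> real) \<Rightarrow> bool" where
  "harmonic_extension P i p \<zeta> \<longleftrightarrow> \<zeta> \<in> local_fe_space P i \<and>
     (\<forall>q\<in>boundary_nodes P i. \<zeta> q = (if q = p then 1 else 0)) \<and>
     (\<forall>v\<in>local_fe_space P i. (\<forall>x\<in>frontier (nbhd P i). v x = 0) \<longrightarrow>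
        energy P (interior (nbhd P i)) \<zeta> v = 0)"

definition snapshot_space :: "'a::euclidean_space gmsfem \<Rightarrow> nat \<Rightarrow> ('a \<Rightarrow> real) set" where
  "snapshot_space P i = fun_span {\<zeta>. \<exists>p\<in>boundary_nodes P i. harmonic_extension P i p \<zeta>}"

definition kappa_tilde :: "'a::euclidean_space gmsfem \<Rightarrow> 'a \<Rightarrow> real" where
  "kappa_tilde P x = kappa P x *
     (\<Sum>r=1..num_nodes P. (mesh_size P)\<^sup>2 * (norm (weak_gradient (dom P) (pou P r) x))\<^sup>2)"

text \<open>Eigenvalues are listed with multiplicity: the \<open>num_snapshots P i\<close> eigenfunctions are linearly independent.
  Positivity of the first eigenvalue is not required, as constants belong to the
  snapshot space and have eigenvalue 0.\<close>

definition offline_eigenpairs :: "'a::euclidean_space gmsfem \<Rightarrow> bool" where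
  "offline_eigenpairs P \<longleftrightarrow>
     (\<forall>i\<in>{1..num_nodes P}.
        (\<forall>k\<in>{1..num_snapshots P i}. eigfun P i k \<in> snapshot_space P i \<and>
           (\<forall>v\<in>snapshot_space P i.
              energy P (interior (nbhd P i)) (eigfun P i k) v =
              eigval P i k *
                (LINT x:interior (nbhd P i)|lebesgue. kappa_tilde P x * eigfun P i k x * v x))) \<and>
        (\<forall>c. (\<forall>x. (\<Sum>k=1..num_snapshots P i. c k * eigfun P i k x) = 0) \<longrightarrow> (\<forall>k\<in>{1..num_snapshots P i}. c k = 0)) \<and>
        mono_on {1..num_snapshots P i} (eigval P i))"

definition offline_basis :: "'a gmsfem \<Rightarrow> nat \<Rightarrow> nat \<Rightarrow> 'a \<Rightarrow> real" where
  "offline_basis P i k x = pou P i x * eigfun P i k x"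

definition offline_space :: "'a gmsfem \<Rightarrow> (nat \<Rightarrow> nat) \<Rightarrow> ('a \<Rightarrow> real) set" where
  "offline_space P l = fun_span {offline_basis P i k |i k. i \<in> {1..num_nodes P} \<and> k \<in> {1..l i}}"

definition galerkin_solution ::
  "'a::euclidean_space gmsfem \<Rightarrow> (nat \<Rightarrow> nat) \<Rightarrow> ('a \<Rightarrow> real) \<Rightarrow> bool" where
  "galerkin_solution P l u \<longleftrightarrow> u \<in> offline_space P l \<and>
     (\<forall>v\<in>offline_space P l. energy P (dom P) u v = load P (dom P) v)"


section \<open>Exact indicators\<close>

definition local_space :: "'a::euclidean_space gmsfem \<Rightarrow> nat \<Rightarrow> ('a \<Rightarrow> real) set" where
  "local_space P i = H10 (interior (nbhd P i)) \<inter> fe_space P"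

definition local_norm :: "'a::euclidean_space gmsfem \<Rightarrow> nat \<Rightarrow> ('a \<Rightarrow> real) \<Rightarrow> real" where
  "local_norm P i v = sqrt (energy P (interior (nbhd P i)) v v)"

definition residual ::
  "'a::euclidean_space gmsfem \<Rightarrow> ('a \<Rightarrow> real) \<Rightarrow> nat \<Rightarrow> ('a \<Rightarrow> real) \<Rightarrow> real" where
  "residual P u i v = load P (interior (nbhd P i)) v - energy P (interior (nbhd P i)) u v"

definition dual_norm ::
  "'a::euclidean_space gmsfem \<Rightarrow> nat \<Rightarrow> (('a \<Rightarrow> real) \<Rightarrow> real) \<Rightarrow> real" where
  "dual_norm P i R = (SUP v\<in>{v \<in> local_space P i. local_norm P i v \<le> 1}. \<bar>R v\<bar>)"

text \<open>The squared indicator for the dimensions \<open>l\<close> and the multiscale solution \<open>u\<close> of one level.\<close>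

definition eta_sq ::
  "'a::euclidean_space gmsfem \<Rightarrow> (nat \<Rightarrow> nat) \<Rightarrow> ('a \<Rightarrow> real) \<Rightarrow> nat \<Rightarrow> real" where
  "eta_sq P l u i = (dual_norm P i (residual P u i))\<^sup>2 * inverse (eigval P i (l i + 1))"


section \<open>Surrogate, marking and enrichment\<close>

text \<open>Posterior mean of a Gaussian process with prior mean \<open>\<mu>\<close>, covariance kernel \<open>k\<close> and noise
  variance \<open>\<tau>\<close>, conditioned on the data \<open>(Z j, y j)\<close>, \<open>j < n\<close>. The weights \<open>\<alpha>\<close> solve the linear system
  of the regularized Gram matrix; since \<open>k\<close> is positive semidefinite, \<open>g\<close> does not depend on
  the choice of \<open>\<alpha>\<close>.\<close>

definition pos_semidef_kernel :: "('z \<Rightarrow> 'z \<Rightarrow> real) \<Rightarrow> bool" where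
  "pos_semidef_kernel k \<longleftrightarrow> (\<forall>z z'. k z z' = k z' z) \<and>
     (\<forall>A c. finite A \<longrightarrow> 0 \<le> (\<Sum>z\<in>A. \<Sum>z'\<in>A. c z * c z' * k z z'))"

definition gp_posterior_mean :: "('z \<Rightarrow> real) \<Rightarrow> bool" where
  "gp_posterior_mean g \<longleftrightarrow> (\<exists>\<mu> k \<tau> n Z y \<alpha>.
     pos_semidef_kernel k \<and> (0::real) \<le> \<tau> \<and>
     (\<forall>j<n::nat. (\<Sum>j'<n. (k (Z j) (Z j') + (if j = j' then \<tau> else 0)) * \<alpha> j') = y j - \<mu> (Z j)) \<and>
     (\<forall>z. g z = \<mu> z + (\<Sum>j<n. \<alpha> j * k z (Z j))))"

definition sorting_permutation :: "nat \<Rightarrow> (nat \<Rightarrow> real) \<Rightarrow> (nat \<Rightarrow> nat) \<Rightarrow> bool" where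
  "sorting_permutation n score \<sigma> \<longleftrightarrow> \<sigma> permutes {1..n} \<and> antimono_on {1..n} (score \<circ> \<sigma>)"

definition num_marked :: "real \<Rightarrow> nat \<Rightarrow> (nat \<Rightarrow> real) \<Rightarrow> (nat \<Rightarrow> nat) \<Rightarrow> nat" where
  "num_marked \<theta> n score \<sigma> =
     (LEAST k. \<theta> * (\<Sum>i=1..n. score i) \<le> (\<Sum>j=1..k. score (\<sigma> j)))"

definition marked :: "real \<Rightarrow> nat \<Rightarrow> (nat \<Rightarrow> real) \<Rightarrow> (nat \<Rightarrow> nat) \<Rightarrow> nat set" where
  "marked \<theta> n score \<sigma> = \<sigma> ` {1..num_marked \<theta> n score \<sigma>}"

text \<open>A run of the method through the levels \<open>1, \<dots>, M\<close>: \<open>l m i\<close> basis functions are used on the \<open>i\<close>-th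
  neighborhood at level \<open>m\<close>, \<open>u m\<close> is the multiscale solution, and \<open>g\<close> is evaluated at the feature
  vectors \<open>feat m i\<close>. The condition on \<open>l m i + 1\<close> makes every indicator of the run well-defined.\<close>

definition adaptive_run ::
  "'a::euclidean_space gmsfem \<Rightarrow> real \<Rightarrow> nat \<Rightarrow> nat \<Rightarrow> (nat \<Rightarrow> nat \<Rightarrow> nat) \<Rightarrow> (nat \<Rightarrow> 'a \<Rightarrow> real) \<Rightarrow>
   ('z::euclidean_space \<Rightarrow> real) \<Rightarrow> (nat \<Rightarrow> nat \<Rightarrow> 'z) \<Rightarrow> (nat \<Rightarrow> nat \<Rightarrow> real) \<Rightarrow>
   (nat \<Rightarrow> nat \<Rightarrow> nat) \<Rightarrow> (nat \<Rightarrow> nat set) \<Rightarrow> bool" where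
  "adaptive_run P \<theta> s M l u g feat score \<sigma> S \<longleftrightarrow>
     1 \<le> s \<and> gp_posterior_mean g \<and>
     (\<forall>m\<in>{1..M}.
        (\<forall>i\<in>{1..num_nodes P}. l m i + 1 \<le> num_snapshots P i \<and> 0 < eigval P i (l m i + 1)) \<and>
        galerkin_solution P (l m) (u m) \<and>
        (\<forall>i\<in>{1..num_nodes P}. score m i = g (feat m i)) \<and>
        sorting_permutation (num_nodes P) (score m) (\<sigma> m) \<and>
        S m = marked \<theta> (num_nodes P) (score m) (\<sigma> m)) \<and>
     (\<forall>m\<in>{1..<M}. \<forall>i\<in>{1..num_nodes P}. l (m + 1) i = l m i + (if i \<in> S m then s else 0))"

end

theory Submission
  imports Defs
begin

text \<open>
  Replacing an indicator by its score changes a sum over an index set by at most the sum of the error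
  bounds there. The replacement is made twice: on the marked set, where the exact indicators must not
  be much smaller than the scores, and on the full index set, where they must not be much larger;
  only the latter error is multiplied by \<open>\<theta>\<close>. The predicted Doerfler condition joins the two
  estimates (\<open>doerfler_perturbation\<close>).

  The error bounds are available only for indices of actual neighborhoods, so the marked set
  has to lie in \<open>{1..N}\<close>. It does, because one of the two extreme choices meets the bulk
  criterion: marking all \<open>N\<close> neighborhoods if the total score is nonnegative, marking none
  otherwise. Hence the least admissible number is at most \<open>N\<close> (\<open>marked_subset\<close>).
\<close>

lemma doerfler_perturbation:
  fixes a b e :: "'i \<Rightarrow> real"
  assumes "S \<subseteq> I" and "0 \<le> \<theta>"
    and close: "\<And>i. i \<in> I \<Longrightarrow> \<bar>a i - b i\<bar> \<le> e i"
    and doerfler: "\<theta> * sum a I \<le> sum a S"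
  shows "\<theta> * sum b I - \<theta> * sum e I - sum e S \<le> sum b S"
proof -
  have "sum b I \<le> (\<Sum>i\<in>I. a i + e i)"
    using close by (intro sum_mono) (force simp add: abs_le_iff)
  then have "\<theta> * sum b I \<le> \<theta> * sum a I + \<theta> * sum e I"
    using mult_left_mono[OF _ \<open>0 \<le> \<theta>\<close>] by (simp add: sum.distrib flip: distrib_left)
  moreover have "sum a S \<le> (\<Sum>i\<in>S. b i + e i)"
    using close \<open>S \<subseteq> I\<close> by (intro sum_mono) (force simp add: abs_le_iff)
  ultimately show ?thesis
    using doerfler by (simp add: sum.distrib)
qed

lemma marked_subset:
  assumes perm: "\<sigma> permutes {1..n}" and "0 \<le> \<theta>" and "\<theta> \<le> 1"
  shows "marked \<theta> n score \<sigma> \<subseteq> {1..n}"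
proof -
  let ?total = "\<Sum>i=1..n. score i"
  have "num_marked \<theta> n score \<sigma> \<le> n"
  proof (cases "0 \<le> ?total")
    case True
    then have "\<theta> * ?total \<le> ?total"
      using mult_right_mono[OF \<open>\<theta> \<le> 1\<close>] by fastforce
    also have "\<dots> = (\<Sum>j=1..n. score (\<sigma> j))"
      using sum.permute[OF perm, of score] by (simp add: comp_def)
    finally show ?thesis
      unfolding num_marked_def by (rule Least_le)
  next
    case False
    then have "\<theta> * ?total \<le> (\<Sum>j=1..0. score (\<sigma> j))"
      using \<open>0 \<le> \<theta>\<close> by (simp add: mult_nonneg_nonpos)
    then have "num_marked \<theta> n score \<sigma> \<le> 0"
      unfolding num_marked_def by (rule Least_le)
    then show ?thesis
      by simp
  qed
  then have "marked \<theta> n score \<sigma> \<subseteq> \<sigma> ` {1..n}"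
    unfolding marked_def by (intro image_mono) auto
  then show ?thesis
    using permutes_image[OF perm] by simp
qed

theorem theorem1:
  fixes P :: "'a::euclidean_space gmsfem"
    and \<theta> :: real and s M m :: nat
    and l :: "nat \<Rightarrow> nat \<Rightarrow> nat" and u :: "nat \<Rightarrow> 'a \<Rightarrow> real"
    and g :: "'z::euclidean_space \<Rightarrow> real" and feat :: "nat \<Rightarrow> nat \<Rightarrow> 'z"
    and score \<epsilon> :: "nat \<Rightarrow> nat \<Rightarrow> real"
    and \<sigma> :: "nat \<Rightarrow> nat \<Rightarrow> nat" and S :: "nat \<Rightarrow> nat set"
  assumes "discretization P" and "partition_functions P" and "offline_eigenpairs P"
    and "0 < \<theta>" and "\<theta> < 1"
    and "adaptive_run P \<theta> s M l u g feat score \<sigma> S"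
    and "1 \<le> m" and "m \<le> M"
    and "\<And>i. i \<in> {1..num_nodes P} \<Longrightarrow> 0 \<le> score m i"
    and "\<And>i. i \<in> {1..num_nodes P} \<Longrightarrow> 0 \<le> \<epsilon> m i"
    and "\<And>i. i \<in> {1..num_nodes P} \<Longrightarrow> \<bar>score m i - eta_sq P (l m) (u m) i\<bar> \<le> \<epsilon> m i"
    and "(\<Sum>i\<in>S m. score m i) \<ge> \<theta> * (\<Sum>i=1..num_nodes P. score m i)"
  shows "(\<Sum>i\<in>S m. eta_sq P (l m) (u m) i) \<ge>
    \<theta> * (\<Sum>i=1..num_nodes P. eta_sq P (l m) (u m) i) - \<theta> * (\<Sum>i=1..num_nodes P. \<epsilon> m i) - (\<Sum>i\<in>S m. \<epsilon> m i)"
proof -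
  have "sorting_permutation (num_nodes P) (score m) (\<sigma> m)"
    and S: "S m = marked \<theta> (num_nodes P) (score m) (\<sigma> m)"
    using assms(6-8) unfolding adaptive_run_def by auto
  then have "\<sigma> m permutes {1..num_nodes P}"
    unfolding sorting_permutation_def by blast
  then have "S m \<subseteq> {1..num_nodes P}"
    unfolding S using assms(4,5) by (intro marked_subset) auto
  then show ?thesis
    using assms(4,11,12) by (intro doerfler_perturbation[where a = "score m"]) auto
qed

end
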